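(* Let $f(x)=r(e^x-1)$, $r>0$, and $g(x)=x$. The equation $$x'(t)=-g\left(\int_0^1 f(x(t-s))\,ds\right)$$ has a period-2 solution, satisfying $x(t)+x(t-1)=c$ for all $t\in\mathbb{R}$ for some constant $c\in\mathbb{R}$, if and only if $r>\pi^2/2$. The period-2 solution is expressed as $$x(t)=\log\left(\frac{K(k)\left(\mathrm{dn}\left(2K(k)t,k\right)+k\,\mathrm{cn}\left(2K(k)t,k\right)\right)^2}{2E(k)-K(k)(1-k^2)}\right),$$ where $k\in(0,1)$ is a unique solution of $$r=2K(k)\left(2E(k)-K(k)(1-k^2)\right)$$ for $r>\pi^2/2$.
   Context: A solution $x:\mathbb{R}\to\mathbb{R}$ of the equation is called a period-2 solution if $x(t)=x(t+2)$ for any $t\in\mathbb{R}$. $\mathrm{cn}(\cdot,k),\mathrm{dn}(\cdot,k)$ are the Jacobi elliptic functions with modulus $k$. $K(k)=\int_0^{\pi/2}\frac{d\theta}{\sqrt{1-k^2\sin^2\theta}}$ and $E(k)=\int_0^{\pi/2}\sqrt{1-k^2\sin^2\theta}\,d\theta$, $0\le k<1$, are the complete elliptic integrals of the first and second kind.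
   Formalization: The period-2 solution in the "if and only if" is required to be nonconstant, since x=0 is one for every r>0; the expression is claimed for solutions of least period 2 and up to a time shift, since shifts and solutions of period 2/3, 2/5, ... also exist. *)

theory Defs
  imports "HOL-Analysis.Analysis"
begin

definition is_solution :: "(real \<Rightarrow> real) \<Rightarrow> (real \<Rightarrow> real) \<Rightarrow> (real \<Rightarrow> real) \<Rightarrow> bool" where
  "is_solution f g x \<longleftrightarrow>
     (\<forall>t. (x has_real_derivative - g (integral {0..1} (\<lambda>s. f (x (t - s))))) (at t))"

(* 2 is merely some period here: equilibria, and solutions of least period 2/3, 2/5, ...,
   are admitted. *)
definition period2_solution :: "(real \<Rightarrow> real) \<Rightarrow> (real \<Rightarrow> real) \<Rightarrow> (real \<Rightarrow> real) \<Rightarrow> bool" where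
  "period2_solution f g x \<longleftrightarrow> is_solution f g x \<and> (\<forall>t. x t = x (t + 2))"

definition least_period :: "(real \<Rightarrow> real) \<Rightarrow> real \<Rightarrow> bool" where
  "least_period x p \<longleftrightarrow>
     0 < p \<and> (\<forall>t. x (t + p) = x t) \<and> (\<forall>q. 0 < q \<and> q < p \<longrightarrow> \<not> (\<forall>t. x (t + q) = x t))"

text \<open>The elliptic functions take the modulus \<open>k\<close> (not the parameter \<open>k^2\<close>), and are
  meant for \<open>0 \<le> k < 1\<close>.\<close>

definition elliptic_K :: "real \<Rightarrow> real" where
  "elliptic_K k = integral {0..pi/2} (\<lambda>\<theta>. 1 / sqrt (1 - k^2 * sin \<theta> ^ 2))"

definition elliptic_E :: "real \<Rightarrow> real" where
  "elliptic_E k = integral {0..pi/2} (\<lambda>\<theta>. sqrt (1 - k^2 * sin \<theta> ^ 2))"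

(* The oriented integral from 0 to \<phi>: one of the two terms vanishes, depending on
   the sign of \<phi>. *)
definition elliptic_F :: "real \<Rightarrow> real \<Rightarrow> real" where
  "elliptic_F \<phi> k =
     integral {0..\<phi>} (\<lambda>\<theta>. 1 / sqrt (1 - k^2 * sin \<theta> ^ 2))
     - integral {\<phi>..0} (\<lambda>\<theta>. 1 / sqrt (1 - k^2 * sin \<theta> ^ 2))"

(* For 0 \<le> k < 1 the integrand is at least 1, so \<phi> \<mapsto> elliptic_F \<phi> k is an increasing
   bijection of the real line and the amplitude is uniquely determined. *)
definition jacobi_am :: "real \<Rightarrow> real \<Rightarrow> real" where
  "jacobi_am u k = (THE \<phi>. elliptic_F \<phi> k = u)"

definition jacobi_cn :: "real \<Rightarrow> real \<Rightarrow> real" where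
  "jacobi_cn u k = cos (jacobi_am u k)"

definition jacobi_dn :: "real \<Rightarrow> real \<Rightarrow> real" where
  "jacobi_dn u k = sqrt (1 - k^2 * sin (jacobi_am u k) ^ 2)"

definition elliptic_profile :: "real \<Rightarrow> real \<Rightarrow> real" where
  "elliptic_profile k t =
     ln (elliptic_K k
           * (jacobi_dn (2 * elliptic_K k * t) k + k * jacobi_cn (2 * elliptic_K k * t) k)^2
         / (2 * elliptic_E k - elliptic_K k * (1 - k^2)))"

end

theory Submission
  imports Defs
begin

text \<open>
  Differentiating \<open>x'(t) = - \<integral>\<^bsub>t-1\<^esub>\<^bsup>t\<^esup> f(x(u)) du\<close> gives \<open>x''(t) = - f(x(t)) + f(x(t-1))\<close>. If
  \<open>x(t) + x(t-1) = c\<close>, the delayed value can be eliminated, and \<open>y = x - c/2\<close> solves the ordinary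
  equation \<open>y'' = - 2 \<mu> sinh y\<close> with \<open>\<mu> = r e\<^bsup>c/2\<^esup>\<close>, subject to \<open>y(t+1) = - y(t)\<close>. Jacobi's functions
  integrate this equation: \<open>wave k u = ln ((dn u + k cn u)\<^sup>2 / (1 - k\<^sup>2))\<close> satisfies
  \<open>wave' = - 2 k sn\<close> and \<open>wave'' = - (1 - k\<^sup>2) sinh wave\<close> and changes sign under \<open>u \<mapsto> u + 2 K(k)\<close>.

  The nonconstant solutions are therefore found as follows. An antiperiodic \<open>y\<close> has a zero with
  negative slope. The modulus \<open>k\<close> and a frequency \<open>\<omega>\<close> can be chosen so that a rescaled wave has the
  same initial data there, and uniqueness for the initial value problem makes the two agree
  everywhere (\<open>second_order_uniqueness\<close>). Antiperiodicity then quantises the frequency,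
  \<open>\<omega> = 2 n K(k)\<close>. Differentiation has lost one constant of integration. It is recovered by
  inserting one point into the delay equation, where the integral of \<open>(dn + k cn)\<^sup>2\<close> is
  elementary up to Jacobi's epsilon function. The result fixes \<open>c\<close> and gives
  \<open>r = n\<^sup>2 h(k)\<close> with \<open>h(k) = 2 K(k) J(k)\<close> and \<open>J(k) = 2 E(k) - (1 - k\<^sup>2) K(k)\<close>
  (\<open>antisymmetric_solution_is_wave\<close>). The case \<open>n = 1\<close> is the profile of the theorem, and the same
  integral shows that it does solve the delay equation (\<open>profile_solution\<close>). For a general \<open>n\<close> the
  wave has period \<open>2/n\<close>, so least period 2 forces \<open>n = 1\<close>.

  Everything else is a statement about \<open>h\<close>: it increases strictly from \<open>h(0) = \<pi>\<^sup>2/2\<close> to infinity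
  on \<open>[0,1)\<close>. Hence \<open>r = h(k)\<close> has exactly one solution when \<open>r > \<pi>\<^sup>2/2\<close>, and \<open>n\<^sup>2 h(k) > \<pi>\<^sup>2/2\<close>
  for every wave. Monotonicity of \<open>K\<close> is visible under the integral sign. That of \<open>J\<close> is not, and
  follows from \<open>J'(k) = k \<integral> cos\<^sup>2\<theta> / \<Delta>(k,\<theta>) d\<theta> > 0\<close> for \<open>k > 0\<close>
  (\<open>elliptic_J_deriv\<close>).
\<close>

section \<open>Oriented integrals of periodic functions\<close>

text \<open>
  This is the pattern in the definition of \<open>elliptic_F\<close>, isolated so that the same facts serve the
  integral of the first kind and the one of the second kind.
\<close>
definition oriented_integral :: "(real \<Rightarrow> real) \<Rightarrow> real \<Rightarrow> real" where
  "oriented_integral w x = integral {0..x} w - integral {x..0} w"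

lemma oriented_integral_0 [simp]: "oriented_integral w 0 = 0"
  by (simp add: oriented_integral_def)

lemma oriented_integral_nonneg: "0 \<le> x \<Longrightarrow> oriented_integral w x = integral {0..x} w"
  by (cases "x = 0") (simp_all add: oriented_integral_def)

lemma oriented_integral_deriv:
  assumes w: "continuous_on UNIV w"
  shows "(oriented_integral w has_real_derivative w x) (at x)"
proof -
  define B where "B = \<bar>x\<bar> + 1"
  have int: "w integrable_on {a..b}" for a b
    using w continuous_on_subset integrable_continuous_interval by blast
  have eq: "oriented_integral w y = integral {-B..y} w - integral {-B..0} w" if "y \<in> {-B<..<B}" for y
  proof (cases "0 \<le> y")
    case True
    moreover have "integral {-B..0} w + integral {0..y} w = integral {-B..y} w"
      using True by (intro Henstock_Kurzweil_Integration.integral_combine int) (auto simp: B_def)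
    ultimately show ?thesis
      by (simp add: oriented_integral_nonneg)
  next
    case False
    moreover have "integral {-B..y} w + integral {y..0} w = integral {-B..0} w"
      using False that by (intro Henstock_Kurzweil_Integration.integral_combine int) auto
    ultimately show ?thesis
      by (simp add: oriented_integral_def)
  qed
  have "((\<lambda>y. integral {-B..y} w) has_real_derivative w x) (at x within {-B..B})"
    using w continuous_on_subset by (intro integral_has_real_derivative) (auto simp: B_def)
  then have "((\<lambda>y. integral {-B..y} w) has_real_derivative w x) (at x)"
    using at_within_Icc_at[of "-B" x B] by (simp add: B_def abs_if split: if_splits)
  then have "((\<lambda>y. integral {-B..y} w - integral {-B..0} w) has_real_derivative w x) (at x)"
    by (auto intro!: derivative_eq_intros)
  then show ?thesis
    by (rule has_field_derivative_transform_within_open[of _ _ _ "{-B<..<B}"])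
       (auto simp: eq B_def)
qed

text \<open>
  Periodicity makes the increment over a full period independent of the starting point, and the
  reflection \<open>\<theta> \<mapsto> \<pi> - \<theta>\<close> makes the two halves of the period contribute equally. Both are read off
  from vanishing derivatives.
\<close>
lemma oriented_integral_add_pi:
  assumes w: "continuous_on UNIV w" and even: "\<And>x. w (- x) = w x" and per: "\<And>x. w (x + pi) = w x"
  shows "oriented_integral w (x + pi) = oriented_integral w x + 2 * oriented_integral w (pi / 2)"
proof -
  let ?W = "oriented_integral w"
  have d [derivative_intros]:
    "((\<lambda>x. ?W (f x)) has_real_derivative w (f x) * f') (at x)"
    if "(f has_real_derivative f') (at x)" for f f' x
    using DERIV_chain2[OF oriented_integral_deriv[OF w] that] .
  have refl: "w (pi - x) = w x" for x
    using even[of "x"] per[of "-x"] by (simp add: algebra_simps)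
  have "((\<lambda>x. ?W (x + pi) - ?W x) has_real_derivative 0) (at x)" for x
    by (auto intro!: derivative_eq_intros simp: per)
  then have A: "?W (x + pi) - ?W x = ?W (0 + pi) - ?W 0"
    by (intro DERIV_isconst_all) auto
  have "((\<lambda>x. ?W (pi - x) + ?W x) has_real_derivative 0) (at x)" for x
    by (auto intro!: derivative_eq_intros simp: refl)
  then have "?W (pi - pi/2) + ?W (pi/2) = ?W (pi - 0) + ?W 0"
    by (intro DERIV_isconst_all) auto
  with A show ?thesis by simp
qed

section \<open>The amplitude function\<close>

definition Delta :: "real \<Rightarrow> real \<Rightarrow> real" where
  "Delta k \<theta> = sqrt (1 - k^2 * sin \<theta> ^ 2)"

lemma Delta_le_1: "Delta k \<theta> \<le> 1"
  by (simp add: Delta_def)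

lemma Delta_periodic: "Delta k (\<theta> + pi) = Delta k \<theta>" "Delta k (- \<theta>) = Delta k \<theta>"
  by (simp_all add: Delta_def)

lemma elliptic_F_eq: "elliptic_F \<phi> k = oriented_integral (\<lambda>\<theta>. 1 / Delta k \<theta>) \<phi>"
  by (simp add: elliptic_F_def oriented_integral_def Delta_def)

lemma dn_eq_Delta: "jacobi_dn u k = Delta k (jacobi_am u k)"
  by (simp add: jacobi_dn_def Delta_def)

lemma continuous_Delta: "continuous_on UNIV (Delta k)"
  unfolding Delta_def by (intro continuous_intros)

lemma elliptic_F_0 [simp]: "elliptic_F 0 k = 0"
  by (simp add: elliptic_F_eq)

lemma k_sin_square_less:
  assumes "\<bar>k\<bar> < 1" shows "k^2 * sin \<theta> ^ 2 < (1::real)"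
proof -
  have "k^2 * sin \<theta> ^ 2 \<le> k^2 * 1"
    by (intro mult_left_mono) (simp_all add: abs_square_le_1)
  also have "\<dots> < 1" using assms by (simp add: abs_square_less_1)
  finally show ?thesis .
qed

context
  fixes k :: real
  assumes abs_k: "\<bar>k\<bar> < 1"
begin

lemma Delta_pos: "0 < Delta k \<theta>"
  using k_sin_square_less[OF abs_k] by (simp add: Delta_def)

lemma Delta_square: "(Delta k \<theta>)\<^sup>2 = 1 - k^2 * sin \<theta> ^ 2"
  using k_sin_square_less[OF abs_k, of \<theta>] by (simp add: Delta_def)

lemma Delta_deriv:
  assumes "(f has_real_derivative f') (at x)"
  shows "((\<lambda>x. Delta k (f x)) has_real_derivative
           - (k^2) * sin (f x) * cos (f x) / Delta k (f x) * f') (at x)"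
proof -
  have aux: "inverse S / 2 * (0 - q * (2 * (c * f' * s))) = - q * s * c / S * f'" for S q c s :: real
    by (simp add: field_simps)
  have pos: "0 < 1 - k^2 * sin (f x) ^ 2"
    using k_sin_square_less[OF abs_k, of "f x"] by simp
  have "((\<lambda>x. sin (f x)) has_real_derivative cos (f x) * f') (at x)"
    using DERIV_chain2[OF DERIV_sin assms] .
  from DERIV_power[OF this, of 2]
  have "((\<lambda>x. 1 - k^2 * sin (f x) ^ 2) has_real_derivative 0 - k^2 * (2 * (cos (f x) * f' * sin (f x)))) (at x)"
    by (intro DERIV_diff DERIV_const DERIV_cmult) (simp add: mult_ac)
  from DERIV_chain2[OF DERIV_real_sqrt[OF pos] this]
  have "((\<lambda>x. sqrt (1 - k^2 * sin (f x) ^ 2)) has_real_derivative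
           - (k^2) * sin (f x) * cos (f x) / sqrt (1 - k^2 * sin (f x) ^ 2) * f') (at x)"
    by (rule DERIV_cong) (rule aux)
  then show ?thesis unfolding Delta_def .
qed

lemma continuous_inverse_Delta: "continuous_on UNIV (\<lambda>\<theta>. 1 / Delta k \<theta>)"
  by (intro continuous_intros continuous_Delta) (metis Delta_pos less_irrefl)

lemma elliptic_F_deriv: "((\<lambda>\<phi>. elliptic_F \<phi> k) has_real_derivative 1 / Delta k \<phi>) (at \<phi>)"
  unfolding elliptic_F_eq[abs_def] by (rule oriented_integral_deriv[OF continuous_inverse_Delta])

lemma elliptic_F_half_pi: "elliptic_F (pi / 2) k = elliptic_K k"
  unfolding elliptic_F_eq elliptic_K_def by (subst oriented_integral_nonneg) (auto simp: Delta_def)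

lemma elliptic_F_add_pi: "elliptic_F (\<phi> + pi) k = elliptic_F \<phi> k + 2 * elliptic_K k"
  using oriented_integral_add_pi[OF continuous_inverse_Delta, of \<phi>]
  by (simp add: elliptic_F_eq elliptic_F_half_pi[symmetric] Delta_periodic)

text \<open>
  The integrand is at least 1. This single estimate yields both injectivity and unboundedness of
  \<open>\<phi> \<mapsto> F(\<phi>,k)\<close>, hence the existence of the amplitude.
\<close>
lemma elliptic_F_minus_id_mono:
  assumes "a \<le> b"
  shows "elliptic_F a k - a \<le> elliptic_F b k - b"
  using assms
proof (rule DERIV_nonneg_imp_nondecreasing)
  fix x
  have "((\<lambda>\<phi>. elliptic_F \<phi> k - \<phi>) has_real_derivative 1 / Delta k x - 1) (at x)"
    by (intro DERIV_diff elliptic_F_deriv DERIV_ident)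
  moreover have "0 \<le> 1 / Delta k x - 1"
    using Delta_pos[of x] Delta_le_1[of k x] by (simp add: field_simps)
  ultimately show "\<exists>y. ((\<lambda>\<phi>. elliptic_F \<phi> k - \<phi>) has_real_derivative y) (at x) \<and> 0 \<le> y"
    by blast
qed

lemma elliptic_F_strict_mono: "a < b \<Longrightarrow> elliptic_F a k < elliptic_F b k"
  using elliptic_F_minus_id_mono[of a b] by simp

lemma elliptic_F_inj: "elliptic_F a k = elliptic_F b k \<longleftrightarrow> a = b"
  by (metis elliptic_F_strict_mono less_irrefl linorder_less_linear)

lemma elliptic_F_surj: "\<exists>\<phi>. elliptic_F \<phi> k = u"
proof -
  let ?B = "\<bar>u\<bar>"
  have "elliptic_F (-?B) k \<le> u" "u \<le> elliptic_F ?B k"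
    using elliptic_F_minus_id_mono[of "-?B" 0] elliptic_F_minus_id_mono[of 0 ?B] by auto
  moreover have "isCont (\<lambda>\<phi>. elliptic_F \<phi> k) x" for x
    using elliptic_F_deriv DERIV_isCont by blast
  ultimately show ?thesis
    using IVT[of "\<lambda>\<phi>. elliptic_F \<phi> k" "-?B" u ?B] by auto
qed

lemma elliptic_F_am: "elliptic_F (jacobi_am u k) k = u"
  unfolding jacobi_am_def
  by (rule theI') (metis elliptic_F_surj elliptic_F_inj)

lemma am_elliptic_F: "jacobi_am (elliptic_F \<phi> k) k = \<phi>"
  using elliptic_F_am[of "elliptic_F \<phi> k"] by (simp add: elliptic_F_inj)

lemma am_0: "jacobi_am 0 k = 0"
  using am_elliptic_F[of 0] by simp

lemma am_K: "jacobi_am (elliptic_K k) k = pi / 2"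
  using am_elliptic_F[of "pi / 2"] by (simp add: elliptic_F_half_pi)

lemma am_add_2K: "jacobi_am (u + 2 * elliptic_K k) k = jacobi_am u k + pi"
  using am_elliptic_F[of "jacobi_am u k + pi"] by (simp add: elliptic_F_add_pi elliptic_F_am)

lemma am_strict_mono: "u < v \<Longrightarrow> jacobi_am u k < jacobi_am v k"
  by (metis elliptic_F_am elliptic_F_strict_mono not_less_iff_gr_or_eq)

lemma am_deriv:
  assumes "(f has_real_derivative f') (at x)"
  shows "((\<lambda>x. jacobi_am (f x) k) has_real_derivative Delta k (jacobi_am (f x) k) * f') (at x)"
proof -
  have "((\<lambda>u. jacobi_am u k) has_real_derivative Delta k (jacobi_am u k)) (at u)" for u
  proof -
    have "isCont (\<lambda>u. jacobi_am u k) (elliptic_F (jacobi_am u k) k)"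
      by (rule isCont_inverse_function[of 1 _ _ "\<lambda>\<phi>. elliptic_F \<phi> k"])
         (auto simp: am_elliptic_F intro: DERIV_isCont[OF elliptic_F_deriv])
    then have "((\<lambda>u. jacobi_am u k) has_real_derivative inverse (1 / Delta k (jacobi_am u k))) (at u)"
      using Delta_pos[of "jacobi_am u k"]
      by (intro DERIV_inverse_function[where a = "u - 1" and b = "u + 1" and f = "\<lambda>\<phi>. elliptic_F \<phi> k"])
         (auto simp: elliptic_F_am intro: elliptic_F_deriv)
    then show ?thesis by simp
  qed
  from DERIV_chain2[OF this assms] show ?thesis .
qed

lemma elliptic_K_pos: "0 < elliptic_K k"
  using elliptic_F_strict_mono[of 0 "pi/2"] by (simp add: elliptic_F_half_pi)

end

section \<open>Elliptic functions and the wave\<close>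

definition jacobi_sn :: "real \<Rightarrow> real \<Rightarrow> real" where
  "jacobi_sn u k = sin (jacobi_am u k)"

text \<open>
  By the ascending Landen transformation this is \<open>(1 + k) E(2 \<surd>k / (1 + k))\<close>. The integral of
  \<open>(dn + k cn)\<^sup>2\<close> over its period \<open>4 K\<close> equals \<open>4 J\<close>.
\<close>
definition elliptic_J :: "real \<Rightarrow> real" where
  "elliptic_J k = 2 * elliptic_E k - elliptic_K k * (1 - k^2)"

text \<open>
  The periodic solution of \<open>y'' = - (1 - k\<^sup>2) sinh y\<close> with extremal values \<open>\<plusminus> ln ((1 + k) / (1 - k))\<close>;
  the maximum is attained at 0.
\<close>
definition wave :: "real \<Rightarrow> real \<Rightarrow> real" where
  "wave k u = 2 * ln (jacobi_dn u k + k * jacobi_cn u k) - ln (1 - k^2)"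

text \<open>
  Jacobi's epsilon function, the primitive of \<open>dn\<^sup>2\<close> that vanishes at 0.
\<close>
definition Epsilon :: "real \<Rightarrow> real \<Rightarrow> real" where
  "Epsilon k u = oriented_integral (Delta k) (jacobi_am u k)"

text \<open>
  A primitive of \<open>(dn + k cn)\<^sup>2\<close>: from \<open>k\<^sup>2 cn\<^sup>2 = dn\<^sup>2 - (1 - k\<^sup>2)\<close> the square equals
  \<open>2 dn\<^sup>2 - (1 - k\<^sup>2) + 2 k cn dn\<close>, and \<open>cn dn\<close> is the derivative of \<open>sn\<close>.
\<close>
definition wave_primitive :: "real \<Rightarrow> real \<Rightarrow> real" where
  "wave_primitive k u = 2 * Epsilon k u - (1 - k^2) * u + 2 * k * jacobi_sn u k"

context
  fixes k :: real
  assumes k0: "0 < k" and k1: "k < 1"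
begin

private lemma abs_k: "\<bar>k\<bar> < 1" using k0 k1 by simp

lemma k_square_less_1: "k^2 < 1"
  using k0 k1 by (simp add: power_less_one_iff)

lemma sn_cn_dn_relations:
  "(jacobi_cn u k)\<^sup>2 = 1 - (jacobi_sn u k)\<^sup>2" "(jacobi_dn u k)\<^sup>2 = 1 - k^2 * (jacobi_sn u k)\<^sup>2"
  "0 < jacobi_dn u k"
  using Delta_square[OF abs_k] Delta_pos[OF abs_k]
  by (simp_all add: jacobi_sn_def jacobi_cn_def dn_eq_Delta cos_squared_eq)

lemma
  assumes f: "(f has_real_derivative f') (at x)"
  shows sn_deriv: "((\<lambda>x. jacobi_sn (f x) k) has_real_derivative jacobi_cn (f x) k * jacobi_dn (f x) k * f') (at x)"
    and cn_deriv: "((\<lambda>x. jacobi_cn (f x) k) has_real_derivative - jacobi_sn (f x) k * jacobi_dn (f x) k * f') (at x)"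
    and dn_deriv: "((\<lambda>x. jacobi_dn (f x) k) has_real_derivative - (k^2) * jacobi_sn (f x) k * jacobi_cn (f x) k * f') (at x)"
proof -
  have am: "((\<lambda>x. jacobi_am (f x) k) has_real_derivative jacobi_dn (f x) k * f') (at x)"
    using am_deriv[OF abs_k f] by (simp add: dn_eq_Delta)
  show "((\<lambda>x. jacobi_sn (f x) k) has_real_derivative jacobi_cn (f x) k * jacobi_dn (f x) k * f') (at x)"
    using DERIV_chain2[OF DERIV_sin am] by (simp add: jacobi_sn_def jacobi_cn_def mult.assoc)
  show "((\<lambda>x. jacobi_cn (f x) k) has_real_derivative - jacobi_sn (f x) k * jacobi_dn (f x) k * f') (at x)"
    using DERIV_chain2[OF DERIV_cos am] by (simp add: jacobi_sn_def jacobi_cn_def mult.assoc)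
  show "((\<lambda>x. jacobi_dn (f x) k) has_real_derivative - (k^2) * jacobi_sn (f x) k * jacobi_cn (f x) k * f') (at x)"
    using Delta_deriv[OF abs_k am] Delta_pos[OF abs_k, of "jacobi_am (f x) k"]
    by (simp add: jacobi_sn_def jacobi_cn_def dn_eq_Delta mult.assoc)
qed

text \<open>
  The two factors are interchanged by \<open>u \<mapsto> u + 2 K\<close>, so this identity is the source of both the
  positivity of \<open>dn + k cn\<close> and the antiperiodicity of the wave.
\<close>
lemma dn_cn_product: "(jacobi_dn u k + k * jacobi_cn u k) * (jacobi_dn u k - k * jacobi_cn u k) = 1 - k^2"
proof -
  have "(jacobi_dn u k + k * jacobi_cn u k) * (jacobi_dn u k - k * jacobi_cn u k)
      = (jacobi_dn u k)\<^sup>2 - k^2 * (jacobi_cn u k)\<^sup>2"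
    by (simp add: algebra_simps power2_eq_square)
  then show ?thesis
    by (simp only: sn_cn_dn_relations) (simp add: algebra_simps)
qed

lemma dn_plus_cn_pos: "0 < jacobi_dn u k + k * jacobi_cn u k"
proof (rule ccontr)
  assume neg: "\<not> ?thesis"
  then have "0 < jacobi_dn u k - k * jacobi_cn u k"
    using sn_cn_dn_relations(3)[of u] by linarith
  with neg have "(jacobi_dn u k + k * jacobi_cn u k) * (jacobi_dn u k - k * jacobi_cn u k) \<le> 0"
    by (simp add: mult_nonpos_nonneg)
  then show False using k_square_less_1 by (simp add: dn_cn_product)
qed

lemma exp_wave: "exp (wave k u) = (jacobi_dn u k + k * jacobi_cn u k)\<^sup>2 / (1 - k^2)"
  using dn_plus_cn_pos[of u] k_square_less_1
  by (simp add: wave_def exp_diff exp_double)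

text \<open>
  Since \<open>e\<^bsup>-wave\<^esup>\<close> is the same expression with \<open>dn - k cn\<close>, the difference of the two squares leaves
  only the cross term. The right-hand side is minus the second derivative of the wave, so this is
  the differential equation of the wave.
\<close>
lemma sinh_wave: "(1 - k^2) * sinh (wave k u) = 2 * k * jacobi_cn u k * jacobi_dn u k"
proof -
  let ?p = "jacobi_dn u k + k * jacobi_cn u k" and ?m = "jacobi_dn u k - k * jacobi_cn u k"
  have p: "?p \<noteq> 0" using dn_plus_cn_pos[of u] by simp
  have q: "1 - k^2 \<noteq> 0" using k_square_less_1 by simp
  have "exp (- wave k u) = (1 - k^2) / ?p\<^sup>2"
    by (simp add: exp_minus exp_wave)
  also have "\<dots> = ?m\<^sup>2 / (1 - k^2)"
    using p q by (simp add: frac_eq_eq dn_cn_product[of u, symmetric] power_mult_distrib[symmetric])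
      (simp add: power2_eq_square mult_ac)
  finally have "sinh (wave k u) = (?p\<^sup>2 / (1 - k^2) - ?m\<^sup>2 / (1 - k^2)) / 2"
    by (simp only: sinh_field_def exp_wave)
  moreover have "q * ((a / q - b / q) / 2) = (a - b) / 2" if "q \<noteq> 0" for a b q :: real
    using that by (simp add: right_diff_distrib)
  ultimately have "(1 - k^2) * sinh (wave k u) = (?p\<^sup>2 - ?m\<^sup>2) / 2"
    using q by (simp only:)
  then show ?thesis by (simp add: power2_eq_square algebra_simps)
qed

lemma wave_deriv:
  assumes f: "(f has_real_derivative f') (at x)"
  shows "((\<lambda>x. wave k (f x)) has_real_derivative - 2 * k * jacobi_sn (f x) k * f') (at x)"
proof -
  let ?p = "jacobi_dn (f x) k + k * jacobi_cn (f x) k"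
  have "((\<lambda>x. jacobi_dn (f x) k + k * jacobi_cn (f x) k) has_real_derivative
     - (k^2) * jacobi_sn (f x) k * jacobi_cn (f x) k * f'
       + k * (- jacobi_sn (f x) k * jacobi_dn (f x) k * f')) (at x)"
    by (intro DERIV_add DERIV_cmult dn_deriv cn_deriv f)
  from DERIV_diff[OF DERIV_cmult[OF DERIV_chain2[OF DERIV_ln_divide[OF dn_plus_cn_pos] this], of 2] DERIV_const]
  show ?thesis unfolding wave_def
    by (rule DERIV_cong) (use dn_plus_cn_pos[of "f x"] in \<open>simp add: field_simps power2_eq_square\<close>)
qed

lemma elliptic_function_shifts:
  "jacobi_sn (u + 2 * elliptic_K k) k = - jacobi_sn u k"
  "jacobi_cn (u + 2 * elliptic_K k) k = - jacobi_cn u k"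
  "jacobi_dn (u + 2 * elliptic_K k) k = jacobi_dn u k"
  by (simp_all add: jacobi_sn_def jacobi_cn_def dn_eq_Delta am_add_2K[OF abs_k] Delta_periodic)

lemma wave_shift: "wave k (u + 2 * elliptic_K k) = - wave k u"
proof -
  let ?p = "jacobi_dn u k + k * jacobi_cn u k" and ?m = "jacobi_dn u k - k * jacobi_cn u k"
  have "0 < ?m" using dn_plus_cn_pos[of "u + 2 * elliptic_K k"] by (simp add: elliptic_function_shifts)
  then have "ln ?p + ln ?m = ln (1 - k^2)"
    using dn_plus_cn_pos[of u] by (simp add: ln_mult_pos[symmetric] dn_cn_product)
  then show ?thesis by (simp add: wave_def elliptic_function_shifts)
qed

lemma am_add_multiple: "jacobi_am (u + 2 * real n * elliptic_K k) k = jacobi_am u k + real n * pi"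
proof (induction n)
  case (Suc n)
  then show ?case
    using am_add_2K[OF abs_k, of "u + 2 * real n * elliptic_K k"] by (simp add: algebra_simps)
qed simp

lemma oriented_integral_Delta_half_pi: "oriented_integral (Delta k) (pi / 2) = elliptic_E k"
  unfolding elliptic_E_def by (subst oriented_integral_nonneg) (auto simp: Delta_def[abs_def])

lemma wave_primitive_deriv:
  "(wave_primitive k has_real_derivative (jacobi_dn u k + k * jacobi_cn u k)\<^sup>2) (at u)"
proof -
  have "((\<lambda>u. oriented_integral (Delta k) (jacobi_am u k)) has_real_derivative
      Delta k (jacobi_am u k) * (Delta k (jacobi_am u k) * 1)) (at u)"
    by (intro DERIV_chain2[OF oriented_integral_deriv[OF continuous_Delta]]
        am_deriv[OF abs_k] DERIV_ident)
  then have "(Epsilon k has_real_derivative (jacobi_dn u k)\<^sup>2) (at u)"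
    by (simp add: Epsilon_def[abs_def] dn_eq_Delta power2_eq_square)
  then have "((\<lambda>u. 2 * Epsilon k u - (1 - k^2) * u + 2 * k * jacobi_sn u k) has_real_derivative
      2 * (jacobi_dn u k)\<^sup>2 - (1 - k^2) * 1 + 2 * k * (jacobi_cn u k * jacobi_dn u k * 1)) (at u)"
    by (intro DERIV_add DERIV_diff DERIV_cmult sn_deriv DERIV_ident)
  moreover have "2 * (jacobi_dn u k)\<^sup>2 - (1 - k^2) = (jacobi_dn u k)\<^sup>2 + k^2 * (jacobi_cn u k)\<^sup>2"
    by (simp only: sn_cn_dn_relations) (simp add: algebra_simps)
  ultimately have "((\<lambda>u. 2 * Epsilon k u - (1 - k^2) * u + 2 * k * jacobi_sn u k) has_real_derivative
      (jacobi_dn u k)\<^sup>2 + k^2 * (jacobi_cn u k)\<^sup>2 + 2 * k * (jacobi_cn u k * jacobi_dn u k)) (at u)"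
    by simp
  then show ?thesis unfolding wave_primitive_def[abs_def]
    by (rule DERIV_cong) (simp add: power2_eq_square algebra_simps)
qed

text \<open>
  The shift is half a period of \<open>sn\<close>. The secular part grows by \<open>4 E - 2 (1 - k\<^sup>2) K = 2 J\<close>, while the
  term \<open>2 k sn\<close> changes sign.
\<close>
lemma wave_primitive_shift:
  "wave_primitive k (u + 2 * elliptic_K k) = wave_primitive k u + 2 * elliptic_J k - 4 * k * jacobi_sn u k"
proof -
  have "Epsilon k (u + 2 * elliptic_K k) = Epsilon k u + 2 * elliptic_E k"
    using oriented_integral_add_pi[OF continuous_Delta, of k "jacobi_am u k"]
    by (simp add: Epsilon_def am_add_2K[OF abs_k] Delta_periodic oriented_integral_Delta_half_pi)
  then show ?thesis
    by (simp only: wave_primitive_def elliptic_J_def elliptic_function_shifts) (simp add: algebra_simps)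
qed

lemma sn_multiple_of_2K: "jacobi_sn (- (2 * real n * elliptic_K k)) k = 0"
proof -
  have "jacobi_am (- (2 * real n * elliptic_K k)) k = - (real n * pi)"
    using am_add_multiple[of "- (2 * real n * elliptic_K k)" n] by (simp add: am_0[OF abs_k])
  then show ?thesis by (simp add: jacobi_sn_def)
qed

lemma wave_primitive_multiple_of_2K:
  "wave_primitive k 0 - wave_primitive k (- (2 * real n * elliptic_K k)) = 2 * real n * elliptic_J k"
proof (induction n)
  case (Suc n)
  then show ?case
    using wave_primitive_shift[of "- (2 * real (Suc n) * elliptic_K k)"] sn_multiple_of_2K[of "Suc n"]
    by (simp add: algebra_simps)
qed simp

end

text \<open>
  The right-hand side of the delay equation has this form, with time running backwards through the
  window.
\<close>
lemma has_integral_window: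
  assumes H: "\<And>u. (H has_real_derivative h u) (at u)" and "\<omega> > (0::real)"
  shows "((\<lambda>s. h (a - \<omega> * s)) has_integral (H a - H (a - \<omega>)) / \<omega>) {0..1}"
proof -
  have "((\<lambda>s. - H (a - \<omega> * s) / \<omega>) has_real_derivative h (a - \<omega> * s)) (at s)" for s
  proof -
    have "((\<lambda>s. a - \<omega> * s) has_real_derivative 0 - \<omega> * 1) (at s)"
      by (intro DERIV_diff DERIV_const DERIV_cmult DERIV_ident)
    from DERIV_cdivide[OF DERIV_minus[OF DERIV_chain2[OF H this]], of \<omega>] show ?thesis
      using assms(2) by simp
  qed
  then have "((\<lambda>s. - H (a - \<omega> * s) / \<omega>) has_vector_derivative h (a - \<omega> * s)) (at s within {0..1})" for s
    by (meson has_field_derivative_at_within has_real_derivative_iff_has_vector_derivative)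
  from fundamental_theorem_of_calculus[OF _ this] show ?thesis
    by (simp add: diff_divide_distrib)
qed

section \<open>The parameter as a function of the modulus\<close>

lemma integrable_over_Delta:
  assumes "\<bar>k\<bar> < 1" "continuous_on {a..b} f"
  shows "(\<lambda>\<theta>. f \<theta> / Delta k \<theta>) integrable_on {a..b}"
proof (rule integrable_continuous_interval)
  have "Delta k x \<noteq> 0" for x using Delta_pos[OF assms(1), of x] by simp
  then show "continuous_on {a..b} (\<lambda>\<theta>. f \<theta> / Delta k \<theta>)"
    using assms(2) unfolding Delta_def by (intro continuous_intros) auto
qed

lemma elliptic_K_integral: "elliptic_K k = integral {0..pi/2} (\<lambda>\<theta>. 1 / Delta k \<theta>)"
  by (simp add: elliptic_K_def Delta_def)

lemma elliptic_J_integral: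
  assumes "\<bar>k\<bar> < 1"
  shows "elliptic_J k = integral {0..pi/2} (\<lambda>\<theta>. (1 + k^2 - 2 * k^2 * sin \<theta> ^ 2) / Delta k \<theta>)"
proof -
  have "(1 + k^2 - 2 * k^2 * sin \<theta> ^ 2) / Delta k \<theta>
     = 2 * sqrt (1 - k^2 * sin \<theta> ^ 2) - (1 - k^2) * (1 / Delta k \<theta>)" for \<theta>
  proof -
    have "(Delta k \<theta>)\<^sup>2 = 1 - k^2 * sin \<theta> ^ 2"
      using k_sin_square_less[OF assms, of \<theta>] by (simp add: Delta_def)
    then have "1 + k^2 - 2 * k^2 * sin \<theta> ^ 2 = 2 * (Delta k \<theta> * Delta k \<theta>) - (1 - k^2)"
      by (simp add: power2_eq_square algebra_simps)
    then have "(1 + k^2 - 2 * k^2 * sin \<theta> ^ 2) / Delta k \<theta> = 2 * Delta k \<theta> - (1 - k^2) * (1 / Delta k \<theta>)"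
      using Delta_pos[OF assms, of \<theta>] by (simp only:) (simp add: diff_divide_distrib)
    then show ?thesis by (simp add: Delta_def)
  qed
  moreover have "((\<lambda>\<theta>. 2 * sqrt (1 - k^2 * sin \<theta> ^ 2) - (1 - k^2) * (1 / Delta k \<theta>)) has_integral
      2 * elliptic_E k - (1 - k^2) * elliptic_K k) {0..pi/2}"
    unfolding elliptic_E_def elliptic_K_integral
    by (intro has_integral_diff has_integral_mult_right integrable_integral
        integrable_over_Delta[OF assms] integrable_continuous_interval continuous_intros)
  ultimately show ?thesis
    by (simp add: elliptic_J_def integral_unique mult.commute)
qed

text \<open>
  A lower bound with an explicit primitive: \<open>artanh (k sin \<theta>)\<close> has derivative
  \<open>k cos \<theta> / \<Delta>\<^sup>2 \<le> 1 / \<Delta>\<close>, because \<open>k\<^sup>2 cos\<^sup>2\<theta> \<le> \<Delta>\<^sup>2\<close>. It shows that \<open>K(k)\<close> tends to infinity as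
  \<open>k\<close> tends to 1.
\<close>
lemma elliptic_K_ge_artanh:
  assumes "0 \<le> k" "k < 1"
  shows "artanh k \<le> elliptic_K k"
proof -
  have D: "((\<lambda>\<theta>. artanh (k * sin \<theta>)) has_real_derivative k * cos \<theta> / (1 - k^2 * sin \<theta> ^ 2)) (at \<theta>)" for \<theta>
  proof -
    have "(k * sin \<theta>)\<^sup>2 < 1" using k_sin_square_less[of k \<theta>] assms by (simp add: power_mult_distrib)
    then have "\<bar>k * sin \<theta>\<bar> < 1" by (simp only: abs_square_less_1)
    from DERIV_chain2[OF artanh_real_has_field_derivative[OF this] DERIV_cmult[OF DERIV_sin]] show ?thesis
      by (simp add: power_mult_distrib)
  qed
  then have "((\<lambda>\<theta>. artanh (k * sin \<theta>)) has_vector_derivative k * cos \<theta> / (1 - k^2 * sin \<theta> ^ 2)) (at \<theta> within {0..pi/2})" for \<theta>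
    by (meson has_field_derivative_at_within has_real_derivative_iff_has_vector_derivative)
  from fundamental_theorem_of_calculus[OF _ this]
  have "((\<lambda>\<theta>. k * cos \<theta> / (1 - k^2 * sin \<theta> ^ 2)) has_integral artanh k) {0..pi/2}" by simp
  moreover have "((\<lambda>\<theta>. 1 / Delta k \<theta>) has_integral elliptic_K k) {0..pi/2}"
    unfolding elliptic_K_integral using assms by (intro integrable_integral integrable_over_Delta) auto
  moreover have "k * cos \<theta> / (1 - k^2 * sin \<theta> ^ 2) \<le> 1 / Delta k \<theta>" for \<theta>
  proof -
    have pos: "0 < 1 - k^2 * sin \<theta> ^ 2" using k_sin_square_less[of k \<theta>] assms by simp
    have "(k * cos \<theta>)\<^sup>2 = k^2 - k^2 * sin \<theta> ^ 2"
      by (simp add: power_mult_distrib cos_squared_eq algebra_simps)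
    also have "\<dots> \<le> 1 - k^2 * sin \<theta> ^ 2" using assms by (simp add: abs_square_le_1)
    finally have "k * cos \<theta> \<le> Delta k \<theta>" unfolding Delta_def by (rule real_le_rsqrt)
    moreover have "1 - k^2 * sin \<theta> ^ 2 = Delta k \<theta> * Delta k \<theta>" using pos by (simp add: Delta_def)
    ultimately show ?thesis using Delta_pos[of k \<theta>] assms
      by (simp only:) (simp add: divide_simps)
  qed
  ultimately show ?thesis by (rule has_integral_le)
qed

lemma elliptic_K_mono:
  assumes "0 \<le> k" "k \<le> l" "l < 1"
  shows "elliptic_K k \<le> elliptic_K l"
  unfolding elliptic_K_integral
proof (rule integral_le)
  fix \<theta> :: real
  have "Delta l \<theta> \<le> Delta k \<theta>"
    using assms by (simp add: Delta_def mult_right_mono power_mono)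
  moreover have "0 < Delta l \<theta>" using assms by (intro Delta_pos) auto
  ultimately show "1 / Delta k \<theta> \<le> 1 / Delta l \<theta>" by (intro divide_left_mono) auto
qed (use assms in \<open>auto intro!: integrable_over_Delta\<close>)

lemma complete_integrals_at_0: "elliptic_K 0 = pi / 2" "elliptic_J 0 = pi / 2"
  by (simp_all add: elliptic_J_def elliptic_K_def elliptic_E_def)

text \<open>
  Differentiating under the integral sign produces an integrand of indefinite sign. It differs from
  \<open>k cos\<^sup>2\<theta> / \<Delta>\<close> by \<open>k\<close> times the \<open>\<theta>\<close>-derivative of \<open>sin \<theta> cos \<theta> / \<Delta>\<close>, a function that vanishes at both
  ends of the interval; what remains is manifestly nonnegative for \<open>k \<ge> 0\<close>.
\<close>
lemma elliptic_J_deriv: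
  assumes k: "\<bar>k\<bar> < 1"
  shows "(elliptic_J has_real_derivative k * integral {0..pi/2} (\<lambda>\<theta>. (cos \<theta>)\<^sup>2 / Delta k \<theta>)) (at k)"
proof -
  let ?U = "{-1<..<1::real}"
  let ?j = "\<lambda>k \<theta>. (1 + k^2 - 2 * k^2 * sin \<theta> ^ 2) / Delta k \<theta>"
  let ?d = "\<lambda>k \<theta>. k * (cos \<theta>)\<^sup>2 / Delta k \<theta> + k * ((1 - 2 * sin \<theta> ^ 2 + k^2 * sin \<theta> ^ 4) / Delta k \<theta> ^ 3)"
  have pos: "0 < Delta l \<theta>" if "l \<in> ?U" for l \<theta>
    using that by (intro Delta_pos) auto
  have sq: "(Delta l \<theta>)\<^sup>2 = 1 - l^2 * sin \<theta> ^ 2" if "l \<in> ?U" for l \<theta>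
  proof -
    have "\<bar>l\<bar> < 1" using that by auto
    from k_sin_square_less[OF this, of \<theta>] show ?thesis by (simp add: Delta_def)
  qed
  have param: "((\<lambda>l. ?j l \<theta>) has_real_derivative ?d l \<theta>) (at l within ?U)" if l: "l \<in> ?U" for l \<theta>
  proof -
    define s where "s = sin \<theta>"
    have "\<bar>l\<bar> < 1" using l by auto
    then have p1: "0 < 1 - l^2 * s^2" using k_sin_square_less[of l \<theta>] by (simp add: s_def)
    have D1: "((\<lambda>l. 1 - l^2 * s^2) has_real_derivative 0 - 2 * l * s^2) (at l)"
      by (auto intro!: derivative_eq_intros)
    have D2: "((\<lambda>l. Delta l \<theta>) has_real_derivative - l * s^2 / Delta l \<theta>) (at l)"
      using DERIV_chain2[OF DERIV_real_sqrt[OF p1] D1] by (simp add: Delta_def s_def field_simps)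
    have D3: "((\<lambda>l. 1 + l^2 - 2 * l^2 * s^2) has_real_derivative 2 * l - 4 * l * s^2) (at l)"
      by (auto intro!: derivative_eq_intros)
    have "((\<lambda>l. ?j l \<theta>) has_real_derivative
       ((2 * l - 4 * l * s^2) * Delta l \<theta> - (1 + l^2 - 2 * l^2 * s^2) * (- l * s^2 / Delta l \<theta>)) / (Delta l \<theta> * Delta l \<theta>)) (at l)"
      using DERIV_divide[OF D3 D2] pos[OF l, of \<theta>] by (simp add: s_def)
    also have "((2 * l - 4 * l * s^2) * Delta l \<theta> - (1 + l^2 - 2 * l^2 * s^2) * (- l * s^2 / Delta l \<theta>)) / (Delta l \<theta> * Delta l \<theta>)
       = ((2 * l - 4 * l * s^2) * (Delta l \<theta>)\<^sup>2 + (1 + l^2 - 2 * l^2 * s^2) * l * s^2) / Delta l \<theta> ^ 3"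
      using pos[OF l, of \<theta>] by (simp add: divide_simps power2_eq_square power3_eq_cube)
    also have "\<dots> = (l * (1 - s^2) * (Delta l \<theta>)\<^sup>2 + l * (1 - 2 * s^2 + l^2 * s^4)) / Delta l \<theta> ^ 3"
      using sq[OF l, of \<theta>] by (simp add: s_def[symmetric]) (simp add: algebra_simps power2_eq_square power4_eq_xxxx)
    also have "\<dots> = l * (1 - s^2) / Delta l \<theta> + l * ((1 - 2 * s^2 + l^2 * s^4) / Delta l \<theta> ^ 3)"
    proof -
      have "(a * d\<^sup>2 + l * b) / d ^ 3 = a / d + l * (b / d ^ 3)" if "d \<noteq> 0" for a b d :: real
        using that by (simp add: add_divide_distrib power2_eq_square power3_eq_cube)
      then show ?thesis using pos[OF l, of \<theta>] by simp
    qed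
    also have "\<dots> = ?d l \<theta>" by (simp add: s_def cos_squared_eq)
    finally show ?thesis by (rule has_field_derivative_at_within)
  qed
  have cont: "continuous_on (?U \<times> cbox 0 (pi/2)) (\<lambda>(l, \<theta>). ?d l \<theta>)"
  proof -
    have "continuous_on (?U \<times> cbox 0 (pi/2)) (\<lambda>p. Delta (fst p) (snd p))"
      unfolding Delta_def by (intro continuous_intros)
    moreover have "Delta (fst p) (snd p) \<noteq> 0" if "p \<in> ?U \<times> cbox 0 (pi/2)" for p
      using pos[of "fst p" "snd p"] that by auto
    ultimately show ?thesis unfolding case_prod_beta by (intro continuous_intros) auto
  qed
  have "((\<lambda>l. integral (cbox 0 (pi/2)) (?j l)) has_real_derivative integral (cbox 0 (pi/2)) (?d k)) (at k within ?U)"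
  proof (rule leibniz_rule_field_derivative[OF param _ cont])
    show "?j l integrable_on cbox 0 (pi/2)" if "l \<in> ?U" for l
      using that by (auto simp: cbox_interval intro!: integrable_over_Delta continuous_intros)
  qed (use k in auto)
  moreover have "at k within ?U = at k" using k by (intro at_within_open) auto
  ultimately have D: "((\<lambda>l. integral {0..pi/2} (?j l)) has_real_derivative integral {0..pi/2} (?d k)) (at k)"
    by (simp add: cbox_interval)
  have "integral {0..pi/2} (?d k) = k * integral {0..pi/2} (\<lambda>\<theta>. (cos \<theta>)\<^sup>2 / Delta k \<theta>)"
  proof -
    let ?g = "\<lambda>\<theta>. (1 - 2 * sin \<theta> ^ 2 + k^2 * sin \<theta> ^ 4) / Delta k \<theta> ^ 3"
    have kU: "k \<in> ?U" using k by auto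
    have "((\<lambda>\<theta>. sin \<theta> * cos \<theta> / Delta k \<theta>) has_real_derivative ?g \<theta>) (at \<theta>)" for \<theta>
    proof -
      define s c where "s = sin \<theta>" and "c = cos \<theta>"
      have c2: "c * c = 1 - s * s" using cos_squared_eq[of \<theta>] by (simp add: s_def c_def power2_eq_square)
      have p1: "0 < 1 - k^2 * sin \<theta> ^ 2" using k_sin_square_less[OF k, of \<theta>] by simp
      have D1: "((\<lambda>\<theta>. 1 - k^2 * sin \<theta> ^ 2) has_real_derivative 0 - k^2 * (2 * s * c)) (at \<theta>)"
        unfolding s_def c_def by (auto intro!: derivative_eq_intros)
      have D2: "(Delta k has_real_derivative - (k^2) * s * c / Delta k \<theta>) (at \<theta>)"
        using DERIV_chain2[OF DERIV_real_sqrt[OF p1] D1] unfolding Delta_def[abs_def] by (simp add: field_simps)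
      have D3: "((\<lambda>\<theta>. sin \<theta> * cos \<theta>) has_real_derivative c * c - s * s) (at \<theta>)"
        unfolding s_def c_def by (auto intro!: derivative_eq_intros)
      have "((\<lambda>\<theta>. sin \<theta> * cos \<theta> / Delta k \<theta>) has_real_derivative
          ((c * c - s * s) * Delta k \<theta> - s * c * (- (k^2) * s * c / Delta k \<theta>)) / (Delta k \<theta> * Delta k \<theta>)) (at \<theta>)"
        using DERIV_divide[OF D3 D2] pos[OF kU, of \<theta>] by (simp add: s_def c_def)
      also have "((c * c - s * s) * Delta k \<theta> - s * c * (- (k^2) * s * c / Delta k \<theta>)) / (Delta k \<theta> * Delta k \<theta>)
          = ((c * c - s * s) * (Delta k \<theta>)\<^sup>2 + k^2 * s * s * (c * c)) / Delta k \<theta> ^ 3"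
        using pos[OF kU, of \<theta>] by (simp add: divide_simps power2_eq_square power3_eq_cube)
      also have "\<dots> = (1 - 2 * s^2 + k^2 * s^4) / Delta k \<theta> ^ 3"
        using sq[OF kU, of \<theta>] unfolding c2 by (simp add: s_def[symmetric]) (simp add: algebra_simps power2_eq_square power4_eq_xxxx)
      finally show ?thesis by (simp add: s_def)
    qed
    then have "((\<lambda>\<theta>. sin \<theta> * cos \<theta> / Delta k \<theta>) has_vector_derivative ?g \<theta>) (at \<theta> within {0..pi/2})" for \<theta>
      by (meson has_field_derivative_at_within has_real_derivative_iff_has_vector_derivative)
    from fundamental_theorem_of_calculus[OF _ this] have "(?g has_integral 0) {0..pi/2}" by simp
    moreover have "((\<lambda>\<theta>. (cos \<theta>)\<^sup>2 / Delta k \<theta>) has_integral integral {0..pi/2} (\<lambda>\<theta>. (cos \<theta>)\<^sup>2 / Delta k \<theta>)) {0..pi/2}"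
      using k by (intro integrable_integral integrable_over_Delta continuous_intros)
    ultimately have "((\<lambda>\<theta>. k * ((cos \<theta>)\<^sup>2 / Delta k \<theta>) + k * ?g \<theta>) has_integral
        k * integral {0..pi/2} (\<lambda>\<theta>. (cos \<theta>)\<^sup>2 / Delta k \<theta>) + k * 0) {0..pi/2}"
      by (intro has_integral_add has_integral_mult_right)
    then show ?thesis by (simp add: integral_unique)
  qed
  with D have "((\<lambda>l. integral {0..pi/2} (?j l)) has_real_derivative
      k * integral {0..pi/2} (\<lambda>\<theta>. (cos \<theta>)\<^sup>2 / Delta k \<theta>)) (at k)" by simp
  then show ?thesis
    by (rule has_field_derivative_transform_within_open[of _ _ _ ?U])
       (use k in \<open>auto simp: elliptic_J_integral\<close>)
qed

text \<open>
  Since \<open>\<Delta> \<le> 1\<close>, the integral in the derivative is at least that of \<open>cos\<^sup>2\<close>, which is \<open>\<pi>/4\<close>.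
\<close>
lemma elliptic_J_strict_mono:
  assumes "0 \<le> k" "k < l" "l < 1"
  shows "elliptic_J k < elliptic_J l"
proof (rule DERIV_pos_imp_increasing_open[OF assms(2)])
  fix x assume x: "k < x" "x < l"
  have "((\<lambda>\<theta>. (\<theta> + sin \<theta> * cos \<theta>) / 2) has_real_derivative (cos \<theta>)\<^sup>2) (at \<theta>)" for \<theta> :: real
    by (auto intro!: derivative_eq_intros simp: power2_eq_square[symmetric] sin_squared_eq)
  then have "((\<lambda>\<theta>. (\<theta> + sin \<theta> * cos \<theta>) / 2) has_vector_derivative (cos \<theta>)\<^sup>2) (at \<theta> within {0..pi/2})" for \<theta> :: real
    by (meson has_field_derivative_at_within has_real_derivative_iff_has_vector_derivative)
  from fundamental_theorem_of_calculus[OF _ this]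
  have "((\<lambda>\<theta>. (cos \<theta>)\<^sup>2) has_integral pi / 4) {0..pi/2}" by simp
  moreover have "((\<lambda>\<theta>. (cos \<theta>)\<^sup>2 / Delta x \<theta>) has_integral integral {0..pi/2} (\<lambda>\<theta>. (cos \<theta>)\<^sup>2 / Delta x \<theta>)) {0..pi/2}"
    using x assms by (intro integrable_integral integrable_over_Delta continuous_intros) auto
  moreover have "(cos \<theta>)\<^sup>2 \<le> (cos \<theta>)\<^sup>2 / Delta x \<theta>" for \<theta>
  proof -
    have "0 < Delta x \<theta>" using x assms by (intro Delta_pos) auto
    moreover have "Delta x \<theta> \<le> 1" by (simp add: Delta_def)
    ultimately show ?thesis using mult_left_le[of "Delta x \<theta>" "(cos \<theta>)\<^sup>2"] by (simp add: pos_le_divide_eq)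
  qed
  ultimately have "pi / 4 \<le> integral {0..pi/2} (\<lambda>\<theta>. (cos \<theta>)\<^sup>2 / Delta x \<theta>)"
    by (rule has_integral_le)
  moreover have "0 < pi / 4" by simp
  ultimately have "0 < x * integral {0..pi/2} (\<lambda>\<theta>. (cos \<theta>)\<^sup>2 / Delta x \<theta>)"
    using x assms by (intro mult_pos_pos) linarith+
  then show "\<exists>y. (elliptic_J has_real_derivative y) (at x) \<and> 0 < y"
    using elliptic_J_deriv[of x] x assms by auto
next
  show "continuous_on {k..l} elliptic_J"
    using assms by (intro continuous_at_imp_continuous_on ballI DERIV_isCont[OF elliptic_J_deriv]) auto
qed

lemma elliptic_J_gt:
  assumes "0 < k" "k < 1"
  shows "pi / 2 < elliptic_J k"
  using elliptic_J_strict_mono[of 0 k] assms by (simp add: complete_integrals_at_0)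

lemma parameter_strict_mono:
  assumes "0 \<le> k" "k < l" "l < 1"
  shows "2 * elliptic_K k * elliptic_J k < 2 * elliptic_K l * elliptic_J l"
proof -
  have "pi / 2 \<le> elliptic_J k"
    using elliptic_J_gt[of k] assms by (cases "k = 0") (auto simp: complete_integrals_at_0)
  then have "0 < elliptic_J k" using pi_gt_zero by linarith
  moreover have "0 < elliptic_K k"
    using elliptic_K_mono[of 0 k] assms complete_integrals_at_0(1) pi_gt_zero by linarith
  ultimately have "elliptic_K k * elliptic_J k < elliptic_K l * elliptic_J l"
    using elliptic_K_mono[of k l] elliptic_J_strict_mono[of k l] assms
    by (intro mult_le_less_imp_less) auto
  then show ?thesis by simp
qed

lemma parameter_gt:
  assumes "0 < k" "k < 1"
  shows "pi^2 / 2 < 2 * elliptic_K k * elliptic_J k"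
  using parameter_strict_mono[of 0 k] assms by (simp add: complete_integrals_at_0 power2_eq_square)

lemma parameter_inj:
  assumes "0 < k" "k < 1" "0 < l" "l < 1" "2 * elliptic_K k * elliptic_J k = 2 * elliptic_K l * elliptic_J l"
  shows "k = l"
  using parameter_strict_mono[of k l] parameter_strict_mono[of l k] assms by (cases k l rule: linorder_cases) auto

text \<open>
  The intermediate value theorem on \<open>[0, tanh r]\<close>: at the right end \<open>K \<ge> artanh (tanh r) = r\<close> and
  \<open>J > \<pi>/2 \<ge> 1\<close>, so \<open>h\<close> already exceeds \<open>r\<close> there.
\<close>
lemma parameter_surj:
  assumes "r > pi^2 / 2"
  shows "\<exists>k. 0 < k \<and> k < 1 \<and> r = 2 * elliptic_K k * elliptic_J k"
proof -
  have "0 < pi^2 / 2" by simp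
  then have r: "0 < r" using assms by linarith
  have t: "0 < tanh r" "tanh r < 1" using r by (simp_all add: tanh_real_lt_1)
  let ?h = "\<lambda>k. 2 * elliptic_K k * elliptic_J k"
  have "r \<le> elliptic_K (tanh r)"
    using elliptic_K_ge_artanh[of "tanh r"] t by (simp add: artanh_tanh_real)
  moreover have "1 \<le> elliptic_J (tanh r)" using elliptic_J_gt[OF t] pi_ge_two by linarith
  ultimately have "r * 1 \<le> elliptic_K (tanh r) * elliptic_J (tanh r)"
    using r by (intro mult_mono) auto
  then have up: "r \<le> ?h (tanh r)" using r by simp
  have low: "?h 0 \<le> r" using assms by (simp add: complete_integrals_at_0 power2_eq_square)
  have "continuous_on ({0..tanh r} \<times> cbox 0 (pi/2)) (\<lambda>(k, \<theta>). 1 / Delta k \<theta>)"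
  proof -
    have "continuous_on ({0..tanh r} \<times> cbox 0 (pi/2)) (\<lambda>p. Delta (fst p) (snd p))"
      unfolding Delta_def by (intro continuous_intros)
    moreover have "Delta (fst p) (snd p) \<noteq> 0" if "p \<in> {0..tanh r} \<times> cbox 0 (pi/2)" for p
      using Delta_pos[of "fst p" "snd p"] that t by auto
    ultimately show ?thesis unfolding case_prod_beta by (intro continuous_intros) auto
  qed
  then have K: "continuous_on {0..tanh r} elliptic_K"
    unfolding elliptic_K_integral[abs_def] by (simp add: cbox_interval integral_continuous_on_param[where a="0::real" and b="pi/2", simplified cbox_interval])
  have "continuous_on {0..tanh r} elliptic_J"
    using t by (intro continuous_at_imp_continuous_on ballI DERIV_isCont[OF elliptic_J_deriv]) auto
  with K have "continuous_on {0..tanh r} ?h" by (intro continuous_intros)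
  from IVT'[OF low up _ this] t obtain k where k: "0 \<le> k" "k \<le> tanh r" "?h k = r" by auto
  moreover have "k \<noteq> 0" using k assms by (auto simp: complete_integrals_at_0 power2_eq_square)
  ultimately show ?thesis using t by (intro exI[of _ k]) auto
qed

section \<open>Uniqueness for autonomous second-order equations\<close>

text \<open>
  On the compact interval between \<open>t0\<close> and \<open>t\<close> both solutions stay in a bounded set, where \<open>\<phi>\<close> is
  Lipschitz. The squared distance \<open>w\<close> of the two phase points then satisfies \<open>\<bar>w'\<bar> \<le> C w\<close>, so
  \<open>e\<^bsup>-Ct\<^esup> w\<close> is nonincreasing and \<open>e\<^bsup>Ct\<^esup> w\<close> is nondecreasing; the first controls later times, the second
  earlier ones.
\<close>
lemma second_order_uniqueness:
  fixes y1 v1 y2 v2 \<phi> \<phi>' :: "real \<Rightarrow> real"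
  assumes y1: "\<And>t. (y1 has_real_derivative v1 t) (at t)" and v1: "\<And>t. (v1 has_real_derivative \<phi> (y1 t)) (at t)"
    and y2: "\<And>t. (y2 has_real_derivative v2 t) (at t)" and v2: "\<And>t. (v2 has_real_derivative \<phi> (y2 t)) (at t)"
    and \<phi>: "\<And>z. (\<phi> has_real_derivative \<phi>' z) (at z)" and \<phi>': "continuous_on UNIV \<phi>'"
    and init: "y1 t0 = y2 t0" "v1 t0 = v2 t0"
  shows "y1 t = y2 t"
proof -
  let ?I = "{min t0 t..max t0 t}"
  have "continuous_on ?I y1" "continuous_on ?I y2"
    using y1 y2 by (meson DERIV_isCont continuous_at_imp_continuous_on)+
  then have "bounded (y1 ` ?I \<union> y2 ` ?I)"
    by (intro compact_imp_bounded compact_Un compact_continuous_image) auto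
  then obtain M where M: "\<And>z. z \<in> y1 ` ?I \<union> y2 ` ?I \<Longrightarrow> \<bar>z\<bar> \<le> M"
    by (auto simp: bounded_iff)
  have "bounded (\<phi>' ` {-M..M})"
    using \<phi>' continuous_on_subset by (intro compact_imp_bounded compact_continuous_image) auto
  then obtain L where L: "\<forall>z\<in>{-M..M}. \<bar>\<phi>' z\<bar> \<le> L"
    by (auto simp: bounded_iff)
  have lip: "\<bar>\<phi> (y1 s) - \<phi> (y2 s)\<bar> \<le> L * \<bar>y1 s - y2 s\<bar>" if "s \<in> ?I" for s
  proof -
    have "norm (\<phi> (y1 s) - \<phi> (y2 s)) \<le> L * norm (y1 s - y2 s)"
    proof (rule field_differentiable_bound)
      show "(\<phi> has_field_derivative \<phi>' z) (at z within {-M..M})" for z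
        using \<phi> has_field_derivative_at_within by blast
    qed (use L M[of "y1 s"] M[of "y2 s"] that in \<open>auto simp: abs_le_iff\<close>)
    then show ?thesis by simp
  qed
  define w where "w s = (y1 s - y2 s)\<^sup>2 + (v1 s - v2 s)\<^sup>2" for s
  define w' where "w' s = 2 * (y1 s - y2 s) * (v1 s - v2 s) + 2 * (v1 s - v2 s) * (\<phi> (y1 s) - \<phi> (y2 s))" for s
  have w: "(w has_real_derivative w' s) (at s)" for s
    unfolding w_def[abs_def] w'_def
    by (auto intro!: derivative_eq_intros y1 y2 v1 v2 simp: algebra_simps)
  define C where "C = 1 + \<bar>L\<bar>"
  have w'_bound: "\<bar>w' s\<bar> \<le> C * w s" if "s \<in> ?I" for s
  proof -
    define d e where "d = \<bar>y1 s - y2 s\<bar>" and "e = \<bar>v1 s - v2 s\<bar>"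
    have "\<bar>w' s\<bar> \<le> 2 * d * e + 2 * e * \<bar>\<phi> (y1 s) - \<phi> (y2 s)\<bar>"
      unfolding w'_def d_def e_def by (rule order_trans[OF abs_triangle_ineq]) (simp only: abs_mult abs_numeral order_refl)
    also have "\<dots> \<le> 2 * d * e + 2 * e * (\<bar>L\<bar> * d)"
    proof -
      have "L * d \<le> \<bar>L\<bar> * d" by (intro mult_right_mono) (auto simp: d_def)
      then have "\<bar>\<phi> (y1 s) - \<phi> (y2 s)\<bar> \<le> \<bar>L\<bar> * d"
        using lip[OF that] unfolding d_def by linarith
      then show ?thesis by (intro add_left_mono mult_left_mono) (auto simp: e_def)
    qed
    also have "\<dots> = C * (2 * d * e)" by (simp add: C_def algebra_simps)
    also have "\<dots> \<le> C * (d\<^sup>2 + e\<^sup>2)"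
      using sum_squares_bound[of d e] by (intro mult_left_mono) (auto simp: C_def)
    also have "\<dots> = C * w s" by (simp add: w_def d_def e_def)
    finally show ?thesis .
  qed
  have w0: "w t0 = 0" by (simp add: w_def init)
  have E: "((\<lambda>s. exp (a * s) * w s) has_real_derivative exp (a * s) * (w' s + a * w s)) (at s)" for a s
    by (auto intro!: derivative_eq_intros w simp: algebra_simps)
  have "w t \<le> 0"
  proof (cases "t0 \<le> t")
    case True
    have "exp (- C * t) * w t \<le> exp (- C * t0) * w t0"
    proof (rule DERIV_nonpos_imp_nonincreasing[OF True])
      fix s assume "t0 \<le> s" "s \<le> t"
      then have "w' s + (- C) * w s \<le> 0" using w'_bound[of s] by auto
      then show "\<exists>D. ((\<lambda>s. exp (- C * s) * w s) has_real_derivative D) (at s) \<and> D \<le> 0"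
        using E[of "- C" s] by (meson exp_ge_zero mult_nonneg_nonpos)
    qed
    then show ?thesis by (simp add: w0 mult_le_0_iff)
  next
    case False
    then have "t \<le> t0" by simp
    then have "exp (C * t) * w t \<le> exp (C * t0) * w t0"
    proof (rule DERIV_nonneg_imp_nondecreasing)
      fix s assume "t \<le> s" "s \<le> t0"
      then have "0 \<le> w' s + C * w s" using w'_bound[of s] by auto
      then show "\<exists>D. ((\<lambda>s. exp (C * s) * w s) has_real_derivative D) (at s) \<and> 0 \<le> D"
        using E[of C s] by (meson exp_ge_zero mult_nonneg_nonneg)
    qed
    then show ?thesis by (simp add: w0 mult_le_0_iff)
  qed
  then have "(y1 t - y2 t)\<^sup>2 \<le> 0" unfolding w_def by (smt (verit) zero_le_power2)
  then show ?thesis by simp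
qed

section \<open>The profile solves the delay equation\<close>

lemma elliptic_J_pos: "0 < k \<Longrightarrow> k < 1 \<Longrightarrow> 0 < elliptic_J k"
  using elliptic_J_gt[of k] pi_gt_zero by linarith

text \<open>
  The value around which the profile oscillates antisymmetrically, that is, \<open>c/2\<close> when the profile
  satisfies \<open>x(t) + x(t-1) = c\<close>.
\<close>
definition profile_mean :: "real \<Rightarrow> real" where
  "profile_mean k = ln (elliptic_K k * (1 - k^2) / elliptic_J k)"

context
  fixes k :: real
  assumes k0: "0 < k" and k1: "k < 1"
begin

private lemma abs_modulus: "\<bar>k\<bar> < 1" using k0 k1 by simp

lemma profile_eq_wave: "elliptic_profile k t = profile_mean k + wave k (2 * elliptic_K k * t)"
proof -
  let ?p = "jacobi_dn (2 * elliptic_K k * t) k + k * jacobi_cn (2 * elliptic_K k * t) k"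
  have "elliptic_profile k t = ln (elliptic_K k * ?p\<^sup>2 / elliptic_J k)"
    by (simp add: elliptic_profile_def elliptic_J_def)
  also have "elliptic_K k * ?p\<^sup>2 / elliptic_J k
      = elliptic_K k * (1 - k^2) / elliptic_J k * exp (wave k (2 * elliptic_K k * t))"
    using k_square_less_1[OF k0 k1] by (simp add: exp_wave[OF k0 k1])
  also have "ln \<dots> = profile_mean k + wave k (2 * elliptic_K k * t)"
    using k_square_less_1[OF k0 k1] elliptic_K_pos[OF abs_modulus] elliptic_J_pos[OF k0 k1]
    by (subst ln_mult_pos) (simp_all add: profile_mean_def)
  finally show ?thesis .
qed

lemma exp_profile_mean: "exp (profile_mean k) = elliptic_K k * (1 - k^2) / elliptic_J k"
  using k_square_less_1[OF k0 k1] elliptic_K_pos[OF abs_modulus] elliptic_J_pos[OF k0 k1]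
  by (simp add: profile_mean_def)

lemma profile_antisymmetric: "elliptic_profile k t + elliptic_profile k (t - 1) = 2 * profile_mean k"
  using wave_shift[OF k0 k1, of "2 * elliptic_K k * (t - 1)"]
  by (simp add: profile_eq_wave algebra_simps)

lemma profile_periodic: "elliptic_profile k (t + 2) = elliptic_profile k t"
  using profile_antisymmetric[of "t + 2"] profile_antisymmetric[of "t + 1"] by (simp add: add.commute)

text \<open>
  A window of length 1 in \<open>t\<close> has length \<open>2 K\<close> in \<open>u = 2 K t\<close>, so the shift rule of the primitive
  evaluates the delay integral. Its secular part contributes exactly 1 to \<open>\<integral> e\<^sup>x\<close>, which cancels the
  constant in \<open>f\<close>; the \<open>sn\<close> term, multiplied by \<open>- r\<close>, is the derivative of the profile.
\<close>
lemma profile_solution: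
  assumes r: "r = 2 * elliptic_K k * elliptic_J k"
  shows "is_solution (\<lambda>x. r * (exp x - 1)) (\<lambda>x. x) (elliptic_profile k)"
  unfolding is_solution_def
proof
  fix t
  let ?K = "elliptic_K k" and ?J = "elliptic_J k"
  let ?sn = "jacobi_sn (2 * ?K * t) k"
  note pos = elliptic_K_pos[OF abs_modulus] elliptic_J_pos[OF k0 k1] k_square_less_1[OF k0 k1]
  define p where "p u = (jacobi_dn u k + k * jacobi_cn u k)\<^sup>2" for u
  have window: "wave_primitive k (2 * ?K * t) - wave_primitive k (2 * ?K * t - 2 * ?K) = 2 * ?J + 4 * k * ?sn"
    using wave_primitive_shift[OF k0 k1, of "2 * ?K * t - 2 * ?K"]
      elliptic_function_shifts(1)[OF k0 k1, of "2 * ?K * t - 2 * ?K"] by simp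
  have "((\<lambda>s. p (2 * ?K * t - 2 * ?K * s)) has_integral (2 * ?J + 4 * k * ?sn) / (2 * ?K)) {0..1}"
    using has_integral_window[of "wave_primitive k" p "2 * ?K" "2 * ?K * t"] pos
      wave_primitive_deriv[OF k0 k1] by (simp add: window p_def)
  moreover have "r * (exp (elliptic_profile k (t - s)) - 1) = r * (?K / ?J * p (2 * ?K * t - 2 * ?K * s) - 1)" for s
  proof -
    have "exp (elliptic_profile k (t - s)) = ?K * (1 - k^2) / ?J * (p (2 * ?K * (t - s)) / (1 - k^2))"
      by (simp add: profile_eq_wave exp_add exp_profile_mean exp_wave[OF k0 k1] p_def)
    also have "\<dots> = ?K / ?J * p (2 * ?K * (t - s))" using pos by simp
    finally show ?thesis by (simp add: right_diff_distrib)
  qed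
  moreover have "((\<lambda>s::real. 1::real) has_integral 1) {0..1}"
    using has_integral_const_real[of "1::real" 0 1] by simp
  ultimately have "((\<lambda>s. r * (exp (elliptic_profile k (t - s)) - 1)) has_integral
      r * (?K / ?J * ((2 * ?J + 4 * k * ?sn) / (2 * ?K)) - 1)) {0..1}"
    by (simp only:) (intro has_integral_mult_right has_integral_diff)
  moreover have "r * (?K / ?J * ((2 * ?J + 4 * k * ?sn) / (2 * ?K)) - 1) = 4 * ?K * k * ?sn"
    using pos unfolding r by (simp add: field_simps)
  ultimately have "((\<lambda>s. r * (exp (elliptic_profile k (t - s)) - 1)) has_integral 4 * ?K * k * ?sn) {0..1}"
    by (simp only:)
  then have "integral {0..1} (\<lambda>s. r * (exp (elliptic_profile k (t - s)) - 1)) = 4 * ?K * k * ?sn"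
    by (rule integral_unique)
  moreover have "(elliptic_profile k has_real_derivative 0 + - 2 * k * ?sn * (2 * ?K * 1)) (at t)"
    unfolding profile_eq_wave[abs_def]
    by (intro DERIV_add DERIV_const wave_deriv[OF k0 k1] DERIV_cmult DERIV_ident)
  ultimately show "(elliptic_profile k has_real_derivative
      - integral {0..1} (\<lambda>s. r * (exp (elliptic_profile k (t - s)) - 1))) (at t)"
    by (simp add: mult_ac)
qed

text \<open>
  A period \<open>q\<close> would return \<open>dn + k cn\<close> to its maximum \<open>1 + k\<close> at \<open>u = 2 K q\<close>, which requires the
  amplitude to be a multiple of \<open>2\<pi>\<close>. For \<open>0 < q < 2\<close> the amplitude lies strictly between 0 and \<open>2\<pi>\<close>.
\<close>
lemma profile_least_period: "least_period (elliptic_profile k) 2"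
  unfolding least_period_def
proof (intro conjI allI impI notI)
  fix q :: real assume q: "0 < q \<and> q < 2" and per: "\<forall>t. elliptic_profile k (t + q) = elliptic_profile k t"
  let ?K = "elliptic_K k" let ?u = "2 * ?K * q"
  have K: "0 < ?K" by (rule elliptic_K_pos[OF abs_modulus])
  have "exp (wave k ?u) = exp (wave k 0)"
    using per[rule_format, of 0] by (simp add: profile_eq_wave)
  then have "(jacobi_dn ?u k + k * jacobi_cn ?u k)\<^sup>2 = (jacobi_dn 0 k + k * jacobi_cn 0 k)\<^sup>2"
    using k_square_less_1[OF k0 k1] by (simp add: exp_wave[OF k0 k1])
  then have "jacobi_dn ?u k + k * jacobi_cn ?u k = 1 + k"
    using dn_plus_cn_pos[OF k0 k1, of ?u] dn_plus_cn_pos[OF k0 k1, of 0] k0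
    by (simp add: power2_eq_iff_nonneg jacobi_dn_def jacobi_cn_def am_0[OF abs_modulus])
  moreover have "jacobi_dn ?u k \<le> 1" by (simp add: jacobi_dn_def)
  ultimately have "k * 1 \<le> k * jacobi_cn ?u k" by linarith
  then have "cos (jacobi_am ?u k) = 1"
    using k0 cos_le_one[of "jacobi_am ?u k"] by (simp add: jacobi_cn_def)
  then obtain n :: int where n: "jacobi_am ?u k = real_of_int n * 2 * pi"
    by (auto simp: cos_one_2pi_int)
  have "?u < 4 * ?K" using q K by simp
  then have "0 < jacobi_am ?u k" "jacobi_am ?u k < 2 * pi"
    using am_strict_mono[OF abs_modulus, of 0 ?u] am_strict_mono[OF abs_modulus, of ?u "4 * ?K"] q K
      am_add_multiple[OF k0 k1, of 0 2] by (simp_all add: am_0[OF abs_modulus])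
  then have "0 < n" "n < 1" using n by (auto simp: zero_less_mult_iff)
  then show False by linarith
qed (simp_all add: profile_periodic)

end

section \<open>Every antisymmetric solution is a wave\<close>

lemma antisymmetric_has_zero:
  fixes y :: "real \<Rightarrow> real"
  assumes "\<And>t. isCont y t" "\<And>t. y (t + 1) = - y t"
  shows "\<exists>t. y t = 0"
proof (cases "y 0 \<le> 0")
  case True
  then show ?thesis using IVT[of y 0 0 1] assms(1) assms(2)[of 0] by auto
next
  case False
  then show ?thesis using IVT2[of y 1 0 0] assms(1) assms(2)[of 0] by auto
qed

text \<open>
  The derivative of the equation determines the solution up to \<open>k\<close>, \<open>\<omega>\<close> and a time shift, by
  matching initial data at a descending zero. Antiperiodicity then gives \<open>\<omega> = 2 n K\<close>, and the
  undifferentiated equation at one time fixes \<open>c\<close> and thereby \<open>r\<close>.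
\<close>
lemma antisymmetric_solution_is_wave:
  assumes r: "r > 0"
    and sol: "is_solution (\<lambda>x. r * (exp x - 1)) (\<lambda>x. x) x"
    and nonconst: "\<not> x constant_on UNIV"
    and anti: "\<And>t. x t + x (t - 1) = c"
  obtains k t0 :: real and n :: nat where "0 < k" "k < 1" "0 < n"
    "r = (real n)\<^sup>2 * (2 * elliptic_K k * elliptic_J k)"
    "\<And>t. x t = profile_mean k + wave k (2 * real n * elliptic_K k * (t - t0) + elliptic_K k)"
proof -
  define v where "v t = - integral {0..1} (\<lambda>s. r * (exp (x (t - s)) - 1))" for t
  have x': "(x has_real_derivative v t) (at t)" for t
    using sol by (simp add: is_solution_def v_def)
  define y where "y t = x t - c / 2" for t
  define \<mu> where "\<mu> = r * exp (c / 2)"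
  have \<mu>: "\<mu> > 0" using r by (simp add: \<mu>_def)
  have y': "(y has_real_derivative v t) (at t)" for t
    unfolding y_def[abs_def] using DERIV_diff[OF x'[of t] DERIV_const[of "c/2"]] by simp
  have y_anti: "y (t + 1) = - y t" for t
    using anti[of "t + 1"] by (simp add: y_def field_simps)
  have v_anti: "v (t + 1) = - v t" for t
  proof -
    have "((\<lambda>t. y (t + 1)) has_real_derivative v (t + 1)) (at t)"
      using y'[of "t + 1"] by (simp add: DERIV_shift)
    moreover have "((\<lambda>t. y (t + 1)) has_real_derivative - v t) (at t)"
      unfolding y_anti by (intro DERIV_minus y')
    ultimately show ?thesis by (rule DERIV_unique)
  qed
  have v': "(v has_real_derivative - 2 * \<mu> * sinh (y t)) (at t)" for t
  proof -
    define h where "h u = r * (exp (x u) - 1)" for u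
    define H where "H = oriented_integral h"
    have "continuous_on UNIV x"
      using x' by (meson DERIV_isCont continuous_at_imp_continuous_on)
    then have "continuous_on UNIV h" unfolding h_def[abs_def] by (intro continuous_intros)
    then have H: "(H has_real_derivative h u) (at u)" for u
      unfolding H_def by (rule oriented_integral_deriv)
    have v_eq: "v = (\<lambda>u. - (H u - H (u - 1)))"
    proof
      fix u
      have "((\<lambda>s. h (u - s)) has_integral H u - H (u - 1)) {0..1}"
        using has_integral_window[OF H, of 1 u] by simp
      then show "v u = - (H u - H (u - 1))"
        unfolding v_def h_def[symmetric] by (simp add: integral_unique)
    qed
    have "((\<lambda>u. H (u - 1)) has_real_derivative h (t - 1)) (at t)"
      using H[of "t - 1"] DERIV_shift[of H _ t "-1"] by simp
    then have "(v has_real_derivative - (h t - h (t - 1))) (at t)"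
      unfolding v_eq by (intro DERIV_minus DERIV_diff H)
    moreover have "- (h t - h (t - 1)) = - 2 * \<mu> * sinh (y t)"
    proof -
      have "x t = c / 2 + y t" "x (t - 1) = c / 2 + - y t"
        using anti[of t] by (simp_all add: y_def field_simps)
      then have "exp (x t) = exp (c / 2) * exp (y t)" "exp (x (t - 1)) = exp (c / 2) * exp (- y t)"
        by (simp_all only: exp_add)
      then show ?thesis
        by (simp add: h_def \<mu>_def sinh_field_def diff_divide_distrib algebra_simps)
    qed
    ultimately show ?thesis by simp
  qed
  have rhs: "((\<lambda>z. - 2 * \<mu> * sinh z) has_real_derivative - 2 * \<mu> * cosh z) (at z)" for z
    by (auto intro!: derivative_eq_intros)
  have rhs': "continuous_on UNIV (\<lambda>z. - 2 * \<mu> * cosh z)" by (intro continuous_intros)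
  note ode_unique = second_order_uniqueness[where \<phi> = "\<lambda>z. - 2 * \<mu> * sinh z" and \<phi>' = "\<lambda>z. - 2 * \<mu> * cosh z"
      and ?y1.0 = y and ?v1.0 = v]
  obtain t1 where t1: "y t1 = 0"
    using antisymmetric_has_zero[OF DERIV_isCont[OF y'] y_anti] by auto
  have "v t1 \<noteq> 0"
  proof
    assume v0: "v t1 = 0"
    have "y t = 0" for t
      by (rule ode_unique[where ?y2.0 = "\<lambda>_. 0" and ?v2.0 = "\<lambda>_. 0" and ?t0.0 = t1,
            OF y' v' _ _ rhs rhs']) (simp_all add: t1 v0)
    then have "x t = c / 2" for t by (simp add: y_def)
    then have "x constant_on UNIV" unfolding constant_on_def by blast
    with nonconst show False by simp
  qed
  \<comment> \<open>The slope changes sign over one unit of time, so \<open>t1\<close> or \<open>t1 + 1\<close> is a descending zero.\<close>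
  then obtain t0 where t0: "y t0 = 0" "v t0 < 0"
    using t1 y_anti[of t1] v_anti[of t1] by (cases "v t1 < 0") (auto simp: not_less)

  \<comment> \<open>The wave \<open>wave k (\<omega> (t - t0) + K)\<close> vanishes at \<open>t0\<close> with slope \<open>- 2 k \<omega>\<close> and solves the equation
    when \<open>\<omega>\<^sup>2 (1 - k\<^sup>2) = 2 \<mu>\<close>. Eliminating \<open>\<omega>\<close> gives \<open>k / \<surd>(1 - k\<^sup>2) = p\<close>.\<close>
  define p where "p = - v t0 / (2 * sqrt (2 * \<mu>))"
  define k where "k = p / sqrt (1 + p^2)"
  define \<omega> where "\<omega> = sqrt (2 * \<mu>) * sqrt (1 + p^2)"
  have p: "0 < p" using t0 \<mu> by (simp add: p_def divide_neg_pos)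
  have P: "0 < 1 + p^2" by (smt (verit) zero_le_power2)
  have sP: "0 < sqrt (1 + p^2)" using P by simp
  have k0: "0 < k" using p sP by (simp add: k_def)
  have k1: "k < 1"
  proof -
    have "p < sqrt (1 + p^2)" by (rule real_less_rsqrt) simp
    then show ?thesis using sP by (simp add: k_def)
  qed
  have "1 - k^2 = 1 / (1 + p^2)"
    using P by (simp add: k_def power_divide field_simps)
  then have \<omega>k: "\<omega>\<^sup>2 * (1 - k^2) = 2 * \<mu>"
    using P \<mu> by (simp add: \<omega>_def power_mult_distrib)
  have \<omega>: "0 < \<omega>" using \<mu> sP by (simp add: \<omega>_def)
  have "k * \<omega> = p * sqrt (2 * \<mu>)" using sP by (simp add: k_def \<omega>_def)
  then have k\<omega>: "- 2 * k * \<omega> = v t0" using \<mu> by (simp add: p_def)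
  let ?K = "elliptic_K k" and ?J = "elliptic_J k"
  have abs_modulus: "\<bar>k\<bar> < 1" using k0 k1 by simp
  note pos = elliptic_K_pos[OF abs_modulus] elliptic_J_pos[OF k0 k1] k_square_less_1[OF k0 k1]
  define a where "a t = \<omega> * (t - t0) + ?K" for t
  have a': "(a has_real_derivative \<omega>) (at t)" for t
    unfolding a_def[abs_def] by (auto intro!: derivative_eq_intros)
  have a_t0: "a t0 = ?K" by (simp add: a_def)
  have z': "((\<lambda>t. wave k (a t)) has_real_derivative - 2 * k * \<omega> * jacobi_sn (a t) k) (at t)" for t
    by (rule DERIV_cong[OF wave_deriv[OF k0 k1 a']]) simp
  have z'': "((\<lambda>t. - 2 * k * \<omega> * jacobi_sn (a t) k) has_real_derivative - 2 * \<mu> * sinh (wave k (a t))) (at t)" for t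
  proof (rule DERIV_cong[OF DERIV_cmult[OF sn_deriv[OF k0 k1 a']]])
    have "- 2 * k * \<omega> * (jacobi_cn (a t) k * jacobi_dn (a t) k * \<omega>) = - \<omega>\<^sup>2 * (2 * k * jacobi_cn (a t) k * jacobi_dn (a t) k)"
      by (simp add: power2_eq_square)
    also have "\<dots> = - (\<omega>\<^sup>2 * (1 - k^2)) * sinh (wave k (a t))"
      by (simp only: sinh_wave[OF k0 k1, symmetric]) simp
    finally show "- 2 * k * \<omega> * (jacobi_cn (a t) k * jacobi_dn (a t) k * \<omega>) = - 2 * \<mu> * sinh (wave k (a t))"
      by (simp only: \<omega>k mult_minus_left)
  qed
  have zero_iff: "wave k u = 0 \<longleftrightarrow> jacobi_cn u k = 0" for u
  proof -
    have "wave k u = 0 \<longleftrightarrow> (1 - k^2) * sinh (wave k u) = 0" using pos by simp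
    also have "\<dots> \<longleftrightarrow> jacobi_cn u k = 0"
      unfolding sinh_wave[OF k0 k1] using k0 sn_cn_dn_relations(3)[OF k0 k1, of u] by simp
    finally show ?thesis .
  qed
  have y_wave: "y t = wave k (a t)" for t
  proof (rule ode_unique[OF y' v' z' z'' rhs rhs'])
    show "y t0 = wave k (a t0)"
      using t0(1) by (simp add: a_t0 zero_iff jacobi_cn_def am_K[OF abs_modulus])
    show "v t0 = - 2 * k * \<omega> * jacobi_sn (a t0) k"
      using k\<omega> by (simp add: a_t0 jacobi_sn_def am_K[OF abs_modulus])
  qed
  have v_wave: "v t = - 2 * k * \<omega> * jacobi_sn (a t) k" for t
    using DERIV_unique[OF y'] z' by (simp add: y_wave[abs_def])

  obtain n :: nat where n: "0 < n" "\<omega> = 2 * real n * ?K"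
  proof -
    have "wave k (\<omega> + ?K) = 0"
      using y_wave[of "t0 + 1"] y_anti[of t0] t0(1) by (simp add: a_def)
    then have "cos (jacobi_am (\<omega> + ?K) k) = 0" by (simp add: zero_iff jacobi_cn_def)
    then obtain i :: int where i: "jacobi_am (\<omega> + ?K) k = real_of_int i * pi + pi / 2"
      by (auto simp: cos_zero_iff_int2)
    moreover have "pi / 2 < jacobi_am (\<omega> + ?K) k"
      using am_strict_mono[OF abs_modulus, of ?K "\<omega> + ?K"] \<omega> by (simp add: am_K[OF abs_modulus])
    ultimately have "0 < i" by (simp add: zero_less_mult_iff)
    then have "jacobi_am (\<omega> + ?K) k = jacobi_am (?K + 2 * real (nat i) * ?K) k"
      by (simp only: i am_add_multiple[OF k0 k1] am_K[OF abs_modulus]) simp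
    then have "\<omega> + ?K = ?K + 2 * real (nat i) * ?K"
      using elliptic_F_am[OF abs_modulus] by metis
    then show ?thesis using that[of "nat i"] \<open>0 < i\<close> by simp
  qed

  have mean: "exp (c / 2) = ?K * (1 - k^2) / ?J"
  proof -
    \<comment> \<open>At this time the argument of the wave is 0, where the derivative vanishes and the delay
      integral involves the primitive only at multiples of \<open>2 K\<close>.\<close>
    define t where "t = t0 - ?K / \<omega>"
    have at: "a (t - s) = 0 - \<omega> * s" for s using \<omega> by (simp add: a_def t_def field_simps)
    define q where "q u = (jacobi_dn u k + k * jacobi_cn u k)\<^sup>2" for u
    have "((\<lambda>s. q (0 - \<omega> * s)) has_integral 2 * real n * ?J / \<omega>) {0..1}"
      using has_integral_window[of "wave_primitive k" q \<omega> 0] wave_primitive_deriv[OF k0 k1] \<omega>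
        wave_primitive_multiple_of_2K[OF k0 k1, of n] by (simp add: q_def n(2))
    moreover have "2 * real n * ?J / \<omega> = ?J / ?K" using n pos by simp
    moreover have "r * (exp (x (t - s)) - 1) = r * (exp (c / 2) / (1 - k^2) * q (0 - \<omega> * s) - 1)" for s
    proof -
      have "x (t - s) = c / 2 + wave k (0 - \<omega> * s)"
        using y_wave[of "t - s"] at[of s] by (simp add: y_def)
      then show ?thesis by (simp add: exp_add exp_wave[OF k0 k1] q_def)
    qed
    moreover have "((\<lambda>s::real. 1::real) has_integral 1) {0..1}"
      using has_integral_const_real[of "1::real" 0 1] by simp
    ultimately have "((\<lambda>s. r * (exp (x (t - s)) - 1)) has_integral
        r * (exp (c / 2) / (1 - k^2) * (?J / ?K) - 1)) {0..1}"
      by (simp only:) (intro has_integral_mult_right has_integral_diff)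
    then have "v t = - (r * (exp (c / 2) / (1 - k^2) * (?J / ?K) - 1))"
      unfolding v_def by (simp only: integral_unique)
    moreover have "v t = 0"
      using v_wave[of t] at[of 0] by (simp add: jacobi_sn_def am_0[OF abs_modulus])
    ultimately have "exp (c / 2) / (1 - k^2) * (?J / ?K) = 1" using r pos by simp
    then show ?thesis using pos by (simp add: field_simps)
  qed
  have "r * (?K * (1 - k^2) / ?J) * 2 = (2 * real n * ?K)\<^sup>2 * (1 - k^2)"
    using \<omega>k unfolding \<mu>_def mean n(2) by simp
  then have "(1 - k^2) * ?K * (2 * r) = (1 - k^2) * ?K * ((2 * real n)\<^sup>2 * ?K * ?J)"
    using pos by (simp add: field_simps power2_eq_square)
  then have "2 * r = (2 * real n)\<^sup>2 * ?K * ?J"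
    using pos by simp
  then have r_eq: "r = (real n)\<^sup>2 * (2 * ?K * ?J)"
    by (simp add: power_mult_distrib)
  have "c / 2 = profile_mean k"
    using mean exp_profile_mean[OF k0 k1] by (metis exp_inj_iff)
  then have "x t = profile_mean k + wave k (2 * real n * ?K * (t - t0) + ?K)" for t
    using y_wave[of t] by (simp add: y_def a_def n(2))
  with k0 k1 n(1) r_eq show ?thesis by (rule that)
qed

section \<open>The onset of period-2 solutions\<close>

theorem theorem13:
  fixes r :: real and f g :: "real \<Rightarrow> real"
  assumes r: "r > 0"
    and f: "f = (\<lambda>x. r * (exp x - 1))"
    and g: "g = (\<lambda>x. x)"
  shows
    "((\<exists>x. period2_solution f g x \<and> \<not> x constant_on UNIV \<and> (\<exists>c. \<forall>t. x t + x (t - 1) = c))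
        \<longleftrightarrow> r > pi^2 / 2)
     \<and> (r > pi^2 / 2 \<longrightarrow>
         (\<exists>!k. k \<in> {0<..<1} \<and>
            r = 2 * elliptic_K k * (2 * elliptic_E k - elliptic_K k * (1 - k^2)))
         \<and> (\<forall>k. k \<in> {0<..<1} \<and>
              r = 2 * elliptic_K k * (2 * elliptic_E k - elliptic_K k * (1 - k^2)) \<longrightarrow>
              period2_solution f g (elliptic_profile k)
              \<and> least_period (elliptic_profile k) 2
              \<and> (\<exists>c. \<forall>t. elliptic_profile k t + elliptic_profile k (t - 1) = c)
              \<and> (\<forall>x. period2_solution f g x \<and> least_period x 2
                      \<and> (\<exists>c. \<forall>t. x t + x (t - 1) = c) \<longrightarrow>
                    (\<exists>\<tau>. \<forall>t. x t = elliptic_profile k (t + \<tau>)))))"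
proof -
  let ?h = "\<lambda>k. 2 * elliptic_K k * elliptic_J k"
  have profile: "period2_solution f g (elliptic_profile k)" "least_period (elliptic_profile k) 2"
      "\<exists>c. \<forall>t. elliptic_profile k t + elliptic_profile k (t - 1) = c"
    if "0 < k" "k < 1" "r = ?h k" for k
    using profile_solution[OF that] profile_periodic[OF that(1,2)] profile_least_period[OF that(1,2)]
      profile_antisymmetric[OF that(1,2)]
    by (auto simp: period2_solution_def f g)
  have nonconst: "\<not> x constant_on UNIV" if "least_period x 2" for x :: "real \<Rightarrow> real"
  proof
    assume "x constant_on UNIV"
    then have "\<forall>t. x (t + 1) = x t" by (auto simp: constant_on_def)
    moreover have "\<not> (\<forall>t. x (t + 1) = x t)"
      using that unfolding least_period_def by auto
    ultimately show False by simp
  qed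
  have bif: "(\<exists>x. period2_solution f g x \<and> \<not> x constant_on UNIV \<and> (\<exists>c. \<forall>t. x t + x (t - 1) = c))
        \<longleftrightarrow> r > pi^2 / 2"
  proof
    assume "\<exists>x. period2_solution f g x \<and> \<not> x constant_on UNIV \<and> (\<exists>c. \<forall>t. x t + x (t - 1) = c)"
    then obtain x c where x: "is_solution f g x" "\<not> x constant_on UNIV" "\<And>t. x t + x (t - 1) = c"
      by (auto simp: period2_solution_def)
    obtain k n where k: "0 < k" "k < 1" "0 < (n::nat)" "r = (real n)\<^sup>2 * ?h k"
      using antisymmetric_solution_is_wave[OF r x(1)[unfolded f g] x(2,3)] by metis
    \<comment> \<open>Waves with \<open>n > 1\<close> are admitted here; they need an even larger \<open>r\<close>.\<close>
    have h: "pi^2 / 2 < ?h k" by (rule parameter_gt[OF k(1,2)])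
    moreover have "0 \<le> pi^2 / 2" by simp
    ultimately have "0 \<le> ?h k" by linarith
    moreover have "1 \<le> (real n)\<^sup>2" using k(3) by (simp add: one_le_power)
    ultimately have "1 * ?h k \<le> r" unfolding k(4) by (intro mult_right_mono)
    with h show "r > pi^2 / 2" by linarith
  next
    assume "r > pi^2 / 2"
    then obtain k where "0 < k" "k < 1" "r = ?h k" using parameter_surj by blast
    then show "\<exists>x. period2_solution f g x \<and> \<not> x constant_on UNIV \<and> (\<exists>c. \<forall>t. x t + x (t - 1) = c)"
      using profile nonconst by blast
  qed
  have unique: "\<exists>!k. k \<in> {0<..<1} \<and> r = ?h k" if "r > pi^2 / 2"
    using parameter_surj[OF that] parameter_inj by (auto intro!: ex_ex1I)
  have shift: "\<exists>\<tau>. \<forall>t. x t = elliptic_profile k (t + \<tau>)"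
    if k: "0 < k" "k < 1" "r = ?h k" and x: "period2_solution f g x" "least_period x 2"
      and anti: "\<And>t. x t + x (t - 1) = c" for k x c
  proof -
    obtain l t0 n where l: "0 < l" "l < 1" "0 < (n::nat)" "r = (real n)\<^sup>2 * ?h l"
      and xl: "\<And>t. x t = profile_mean l + wave l (2 * real n * elliptic_K l * (t - t0) + elliptic_K l)"
      using antisymmetric_solution_is_wave[OF r _ nonconst[OF x(2)] anti] x(1)
      unfolding period2_solution_def f g by metis
    have "x (t + 2 / real n) = x t" for t
    proof -
      let ?u = "2 * real n * elliptic_K l * (t - t0) + elliptic_K l"
      have "2 * real n * elliptic_K l * (t + 2 / real n - t0) + elliptic_K l
          = ?u + 2 * elliptic_K l + 2 * elliptic_K l"
        using l(3) by (simp add: field_simps)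
      then have "wave l (2 * real n * elliptic_K l * (t + 2 / real n - t0) + elliptic_K l) = wave l ?u"
        by (simp only: wave_shift[OF l(1,2)] minus_minus)
      then show ?thesis by (simp only: xl)
    qed
    then have "\<not> (0 < 2 / real n \<and> 2 / real n < 2)"
      using x(2) unfolding least_period_def by blast
    then have n: "n = 1" using l(3) by (auto simp: divide_less_eq)
    then have "l = k" using l k parameter_inj[of l k] by simp
    \<comment> \<open>The wave passes through its descending zero at \<open>u = K\<close>, that is, the profile at \<open>t = 1/2\<close>.\<close>
    then have "x t = elliptic_profile k (t + (1 / 2 - t0))" for t
      unfolding xl n profile_eq_wave[OF k(1,2)] by (simp add: algebra_simps)
    then show ?thesis by blast
  qed
  show ?thesis
    unfolding elliptic_J_def [symmetric]
  proof (intro conjI impI allI)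
    show "\<exists>\<tau>. \<forall>t. x t = elliptic_profile k (t + \<tau>)"
      if "k \<in> {0<..<1} \<and> r = ?h k"
        "period2_solution f g x \<and> least_period x 2 \<and> (\<exists>c. \<forall>t. x t + x (t - 1) = c)" for k x
      using that shift[of k x] by auto
  qed (use bif unique profile in auto)
qed

end
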